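(* The sequence $n\mapsto \mathrm{Vol}(\mathcal{M}_n)^{1/\binom{n}{2}}$, indexed by integers $n\ge 2$, is non-increasing.
   Context: For an integer $n\ge 2$ write $[n]=\{1,\dots,n\}$ and let $\binom{[n]}{2}$ be the set of unordered pairs of distinct elements of $[n]$. The metric polytope $\mathcal{M}_n\subseteq\mathbb{R}^{\binom{n}{2}}$ is the set of all arrays $(d_{ij})$ indexed by $\{i,j\}\in\binom{[n]}{2}$ (with $d_{ij}=d_{ji}$) such that $0<d_{ij}\le 2$ for all $\{i,j\}$ and $d_{ij}\le d_{ik}+d_{kj}$ for all distinct $i,j,k\in[n]$. $\mathrm{Vol}$ denotes Lebesgue measure in $\mathbb{R}^{\binom{n}{2}}$. *)

theory Defs
  imports "HOL-Analysis.Analysis" "HOL-Library.Ramsey"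
begin

text \<open>
  The space of real arrays indexed by the 2-element subsets of \<open>{1..n}\<close> consists of the functions
  that are \<open>undefined\<close> outside that index set. Indexing by sets \<open>{i, j}\<close> builds in the symmetry
  \<open>d\<^sub>i\<^sub>j = d\<^sub>j\<^sub>i\<close>.
\<close>

definition metric_polytope :: "nat \<Rightarrow> (nat set \<Rightarrow> real) set" where
  "metric_polytope n =
     {d \<in> nsets {1..n} 2 \<rightarrow>\<^sub>E UNIV.
        (\<forall>e \<in> nsets {1..n} 2. 0 < d e \<and> d e \<le> 2) \<and>
        (\<forall>i \<in> {1..n}. \<forall>j \<in> {1..n}. \<forall>k \<in> {1..n}.
           i \<noteq> j \<and> j \<noteq> k \<and> i \<noteq> k \<longrightarrow> d {i, j} \<le> d {i, k} + d {k, j})}"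

definition pair_lborel :: "nat \<Rightarrow> (nat set \<Rightarrow> real) measure" where
  "pair_lborel n = (\<Pi>\<^sub>M e \<in> nsets {1..n} 2. lborel)"

text \<open>
  The polytope is a Borel set, so its measure under the product of Borel-Lebesgue measures is its
  Lebesgue measure, and not the default value \<open>0\<close> that \<^const>\<open>measure\<close> gives to non-measurable sets.
\<close>

lemma sets_metric_polytope: "metric_polytope n \<in> sets (pair_lborel n)"
proof -
  let ?I = "nsets {1..n} 2"
  have fin: "finite ?I"
    by (simp add: finite_imp_finite_nsets)
  have comp: "(\<lambda>d. d e) \<in> borel_measurable (pair_lborel n)" if "e \<in> ?I" for e
    using measurable_component_singleton[OF that, of "\<lambda>_. lborel"]
    by (simp add: pair_lborel_def)
  have I: "{i, j} \<in> ?I" if "i \<in> {1..n}" "j \<in> {1..n}" "i \<noteq> j" for i j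
    using that by (auto simp: nsets_def)
  have "{d \<in> space (pair_lborel n). \<forall>e \<in> ?I. 0 < d e \<and> d e \<le> 2} \<in> sets (pair_lborel n)"
  proof (rule sets.sets_Collect_finite_All[OF _ fin])
    fix e assume "e \<in> ?I"
    from comp[OF this]
    show "{d \<in> space (pair_lborel n). 0 < d e \<and> d e \<le> 2} \<in> sets (pair_lborel n)"
      by measurable
  qed
  moreover have "{d \<in> space (pair_lborel n).
      i \<noteq> j \<and> j \<noteq> k \<and> i \<noteq> k \<longrightarrow> d {i, j} \<le> d {i, k} + d {k, j}} \<in> sets (pair_lborel n)"
    if "i \<in> {1..n}" "j \<in> {1..n}" "k \<in> {1..n}" for i j k
  proof (cases "i \<noteq> j \<and> j \<noteq> k \<and> i \<noteq> k")
    case True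
    have m: "(\<lambda>d. d {i, j}) \<in> borel_measurable (pair_lborel n)"
      "(\<lambda>d. d {i, k} + d {k, j}) \<in> borel_measurable (pair_lborel n)"
      using that True by (intro comp I borel_measurable_add; simp)+
    show ?thesis
      using borel_measurable_le[OF m] True by simp
  next
    case False
    then have "{d \<in> space (pair_lborel n).
      i \<noteq> j \<and> j \<noteq> k \<and> i \<noteq> k \<longrightarrow> d {i, j} \<le> d {i, k} + d {k, j}} = space (pair_lborel n)"
      by blast
    then show ?thesis
      by (simp only: sets.top)
  qed
  then have "{d \<in> space (pair_lborel n). \<forall>i \<in> {1..n}. \<forall>j \<in> {1..n}. \<forall>k \<in> {1..n}.
      i \<noteq> j \<and> j \<noteq> k \<and> i \<noteq> k \<longrightarrow> d {i, j} \<le> d {i, k} + d {k, j}} \<in> sets (pair_lborel n)"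
    by (intro sets.sets_Collect_finite_All finite_atLeastAtMost)
  ultimately have "{d \<in> space (pair_lborel n). (\<forall>e \<in> ?I. 0 < d e \<and> d e \<le> 2) \<and>
      (\<forall>i \<in> {1..n}. \<forall>j \<in> {1..n}. \<forall>k \<in> {1..n}.
      i \<noteq> j \<and> j \<noteq> k \<and> i \<noteq> k \<longrightarrow> d {i, j} \<le> d {i, k} + d {k, j})} \<in> sets (pair_lborel n)"
    by (intro sets.sets_Collect_conj)
  moreover have "space (pair_lborel n) = ?I \<rightarrow>\<^sub>E UNIV"
    by (simp add: pair_lborel_def space_PiM)
  ultimately show ?thesis
    by (simp add: metric_polytope_def)
qed

end

theory Submission imports Defs begin

text \<open>
  Forgetting a vertex \<open>v\<close> of a point of \<open>\<M>\<^sub>n\<^sub>+\<^sub>1\<close> gives, after relabelling, a point of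
  \<open>\<M>\<^sub>n\<close>, and each pair survives for exactly \<open>n - 1\<close> of the \<open>n + 1\<close> choices of \<open>v\<close>. The
  Shearer--Finner inequality, a Loomis--Whitney inequality for uniform covers, therefore gives
  \<open>Vol(\<M>\<^sub>n\<^sub>+\<^sub>1)\<^sup>n\<^sup>-\<^sup>1 \<le> Vol(\<M>\<^sub>n)\<^sup>n\<^sup>+\<^sup>1\<close>, which is the claim because
  \<open>(n - 1) (n + 1 choose 2) = (n + 1) (n choose 2)\<close>. The inequality is proved by induction on
  the coordinates: integrating out one coordinate is an application of Hoelder's inequality to
  the \<open>k\<close> factors that depend on it.
\<close>

section \<open>Roots of extended non-negative reals\<close>

text \<open>Infinity is treated separately because \<open>enn2real top\<close> is 0, so the real
  root alone would send \<open>top\<close> to 0.\<close>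

definition ennroot :: "nat \<Rightarrow> ennreal \<Rightarrow> ennreal" where
  "ennroot k x = (if x = top then top else ennreal (root k (enn2real x)))"

lemma ennroot_top [simp]: "ennroot k top = top"
  by (simp add: ennroot_def)

lemma ennroot_ennreal: "0 \<le> r \<Longrightarrow> ennroot k (ennreal r) = ennreal (root k r)"
  by (simp add: ennroot_def)

lemma ennroot_1 [simp]: "k > 0 \<Longrightarrow> ennroot k 1 = 1"
  by (simp add: ennroot_def)

lemma ennroot_eq_0_iff [simp]: "k > 0 \<Longrightarrow> ennroot k x = 0 \<longleftrightarrow> x = 0"
  by (cases x) (auto simp: ennroot_ennreal)

lemma ennroot_power [simp]: "k > 0 \<Longrightarrow> ennroot k x ^ k = x"
  by (cases x) (auto simp: ennroot_ennreal ennreal_power power_top_ennreal)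

lemma borel_measurable_ennroot [measurable (raw)]:
  assumes [measurable]: "f \<in> borel_measurable M"
  shows "(\<lambda>x. ennroot k (f x)) \<in> borel_measurable M"
proof -
  have [measurable]: "root k \<in> borel_measurable borel"
    by (intro borel_measurable_continuous_onI continuous_on_real_root continuous_on_id)
  show ?thesis
    unfolding ennroot_def by measurable
qed

lemma real_root_prod:
  assumes "k > 0"
  shows "root k (\<Prod>j\<in>J. f j) = (\<Prod>j\<in>J. root k (f j))"
  using assms by (induction J rule: infinite_finite_induct) (simp_all add: real_root_mult)

section \<open>Hoelder's inequality for \<open>k\<close> factors\<close>

text \<open>AM-GM for the normalised quotients \<open>y j / a j\<close>. In the application
  \<open>a j\<close> is the integral of the \<open>j\<close>-th factor, so that the sum on the right
  integrates to 1.\<close>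

lemma prod_ennroot_le_weighted_sum:
  fixes y a :: "'a \<Rightarrow> ennreal"
  assumes J: "finite J" "J \<noteq> {}" "card J = k"
    and a: "\<And>j. j \<in> J \<Longrightarrow> a j \<noteq> 0 \<and> a j \<noteq> top"
  shows "(\<Prod>j\<in>J. ennroot k (y j)) \<le> (\<Prod>j\<in>J. ennroot k (a j)) * (\<Sum>j\<in>J. y j / a j / of_nat k)"
proof (cases "\<exists>j\<in>J. y j = top")
  case True
  then obtain i where i: "i \<in> J" "y i = top" by blast
  have k: "k > 0" using J by (auto simp: card_gt_0_iff)
  \<comment> \<open>An infinite \<open>y i\<close> makes the right-hand side infinite: finiteness of
    \<open>a i\<close> keeps the quotient infinite, and non-zero \<open>a j\<close> keep the product
    of roots from annihilating the sum.\<close>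
  have "y i / a i / of_nat k = top"
    using i a[of i] by (simp add: ennreal_top_divide less_top)
  then have "(\<Sum>j\<in>J. y j / a j / of_nat k) = top"
    using i by (subst sum.remove[OF J(1) i(1)]) simp
  moreover have "(\<Prod>j\<in>J. ennroot k (a j)) \<noteq> 0"
    using a k by simp
  ultimately have "(\<Prod>j\<in>J. ennroot k (a j)) * (\<Sum>j\<in>J. y j / a j / of_nat k) = top"
    by (simp only: ennreal_mult_top if_False)
  then show ?thesis
    by (simp only: top_greatest)
next
  case False
  have k: "k > 0" using J by (auto simp: card_gt_0_iff)
  define z b where "z j = enn2real (y j)" and "b j = enn2real (a j)" for j
  have z: "y j = ennreal (z j)" "0 \<le> z j" if "j \<in> J" for j
    using False that by (auto simp: z_def less_top)
  have b: "a j = ennreal (b j)" "0 < b j" if "j \<in> J" for j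
    using a[OF that] by (auto simp: b_def less_top enn2real_positive_iff zero_less_iff_neq_zero)
  have "(\<Prod>j\<in>J. root k (z j)) = (\<Prod>j\<in>J. root k (b j)) * (\<Prod>j\<in>J. root k (z j / b j))"
    using b(2) k by (subst prod.distrib[symmetric], intro prod.cong)
      (auto simp: real_root_divide less_imp_neq[symmetric])
  also have "(\<Prod>j\<in>J. root k (z j / b j)) = root k (\<Prod>j\<in>J. z j / b j)"
    by (rule real_root_prod[OF k, symmetric])
  finally have eq: "(\<Prod>j\<in>J. root k (z j)) = (\<Prod>j\<in>J. root k (b j)) * root k (\<Prod>j\<in>J. z j / b j)" .
  \<comment> \<open>As \<open>card J = k\<close>, this \<open>k\<close>-th root is the geometric
    mean of all the quotients.\<close>
  have am_gm: "root k (\<Prod>j\<in>J. z j / b j) \<le> (\<Sum>j\<in>J. z j / b j / k)"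
  proof -
    have nn: "z j / b j \<ge> 0" if "j \<in> J" for j using z(2) b(2) that by (simp add: less_imp_le)
    show ?thesis
      using arith_geom_mean[OF J(1,2), of "\<lambda>j. z j / b j"] nn k J(3)
      by (auto simp: root_powr_inverse prod_nonneg)
  qed
  have "ennreal (\<Prod>j\<in>J. root k (z j)) \<le>
      ennreal ((\<Prod>j\<in>J. root k (b j)) * (\<Sum>j\<in>J. z j / b j / k))"
    unfolding eq using b k by (intro ennreal_leI mult_left_mono am_gm prod_nonneg) (simp add: less_imp_le)
  also have "\<dots> = (\<Prod>j\<in>J. ennroot k (a j)) * (\<Sum>j\<in>J. y j / a j / of_nat k)"
  proof -
    have pos: "0 \<le> root k (b j)" "0 \<le> z j / b j / k" if "j \<in> J" for j
      using z(2)[OF that] b(2)[OF that] k by simp_all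
    have "(\<Sum>j\<in>J. y j / a j / of_nat k) = (\<Sum>j\<in>J. ennreal (z j / b j / k))"
      using z b k by (intro sum.cong) (simp_all add: divide_ennreal divide_nonneg_pos ennreal_of_nat_eq_real_of_nat)
    also have "\<dots> = ennreal (\<Sum>j\<in>J. z j / b j / k)"
      using pos(2) by (rule sum_ennreal)
    finally have sum: "(\<Sum>j\<in>J. y j / a j / of_nat k) = ennreal (\<Sum>j\<in>J. z j / b j / k)" .
    have "(\<Prod>j\<in>J. ennroot k (a j)) = (\<Prod>j\<in>J. ennreal (root k (b j)))"
      using b by (intro prod.cong) (auto simp: ennroot_ennreal less_imp_le)
    also have "\<dots> = ennreal (\<Prod>j\<in>J. root k (b j))"
      using pos(1) by (rule prod_ennreal)
    finally have prod: "(\<Prod>j\<in>J. ennroot k (a j)) = ennreal (\<Prod>j\<in>J. root k (b j))" .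
    show ?thesis
      unfolding sum prod using pos by (intro ennreal_mult prod_nonneg sum_nonneg)
  qed
  also have "ennreal (\<Prod>j\<in>J. root k (z j)) = (\<Prod>j\<in>J. ennroot k (y j))"
    using z k by (subst prod_ennreal[symmetric]) (auto intro!: prod.cong simp: ennroot_ennreal real_root_ge_zero)
  finally show ?thesis .
qed

text \<open>Hoelder's inequality with all exponents equal to \<open>k\<close>: integrate the
  pointwise AM-GM bound, each factor being normalised by its own integral. That needs the integrals
  to be non-zero and finite; the other cases are degenerate.\<close>

lemma nn_integral_prod_ennroot_le:
  fixes F :: "'i \<Rightarrow> 'a \<Rightarrow> ennreal"
  assumes J: "finite J" "J \<noteq> {}" "card J = k"
    and [measurable]: "\<And>j. j \<in> J \<Longrightarrow> F j \<in> borel_measurable M"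
  shows "(\<integral>\<^sup>+x. (\<Prod>j\<in>J. ennroot k (F j x)) \<partial>M) \<le> (\<Prod>j\<in>J. ennroot k (\<integral>\<^sup>+x. F j x \<partial>M))"
proof -
  have k: "k > 0" using J by (auto simp: card_gt_0_iff)
  let ?a = "\<lambda>j. \<integral>\<^sup>+x. F j x \<partial>M"
  \<comment> \<open>Since 0 times \<open>top\<close> is 0 in \<open>ennreal\<close>, an infinite
    integral makes the right-hand side infinite only when no other integral vanishes; hence the
    third condition in case \<open>top\<close>.\<close>
  consider (zero) i where "i \<in> J" "?a i = 0"
    | (top) i where "i \<in> J" "?a i = top" "\<forall>j\<in>J. ?a j \<noteq> 0"
    | (fin) "\<forall>j\<in>J. ?a j \<noteq> 0 \<and> ?a j \<noteq> top"
    by blast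
  then show ?thesis
  proof cases
    case zero
    \<comment> \<open>A factor with integral 0 vanishes almost everywhere, and the whole product
      with it.\<close>
    then have "AE x in M. F i x = 0"
      by (subst (asm) nn_integral_0_iff_AE) auto
    then have "AE x in M. (\<Prod>j\<in>J. ennroot k (F j x)) = 0"
      by eventually_elim (use zero J k in auto)
    then have "(\<integral>\<^sup>+x. (\<Prod>j\<in>J. ennroot k (F j x)) \<partial>M) = 0"
      by (subst nn_integral_cong_AE[where v = "\<lambda>_. 0"]) auto
    then show ?thesis by simp
  next
    case top
    then have "ennroot k (?a i) = top" by simp
    then have "(\<Prod>j\<in>J. ennroot k (?a j)) = top"
      using top(1,3) J(1) k by (subst ennreal_prod_eq_top) (auto intro!: bexI[of _ i])
    then show ?thesis by simp
  next
    case fin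
    have "(\<integral>\<^sup>+x. (\<Prod>j\<in>J. ennroot k (F j x)) \<partial>M)
        \<le> (\<integral>\<^sup>+x. (\<Prod>j\<in>J. ennroot k (?a j)) * (\<Sum>j\<in>J. F j x / ?a j / of_nat k) \<partial>M)"
      using fin J by (intro nn_integral_mono prod_ennroot_le_weighted_sum) auto
    also have "\<dots> = (\<Prod>j\<in>J. ennroot k (?a j)) * (\<Sum>j\<in>J. ?a j / ?a j / of_nat k)"
      by (subst nn_integral_cmult, simp, subst nn_integral_sum)
        (auto simp: nn_integral_divide)
    also have "(\<Sum>j\<in>J. ?a j / ?a j / of_nat k) = (\<Sum>j\<in>J. 1 / of_nat k :: ennreal)"
      using fin by (intro sum.cong) (auto simp: less_top)
    also have "\<dots> = 1"
      using J k by (simp add: ennreal_times_divide ennreal_divide_self of_nat_less_top)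
    finally show ?thesis by simp
  qed
qed

section \<open>The Shearer-Finner inequality on finite products\<close>

text \<open>Finner's inequality, in the case that each coordinate occurs in exactly \<open>k\<close> of the factors.\<close>

lemma (in product_sigma_finite) nn_integral_PiM_prod_ennroot_le:
  fixes F :: "'v \<Rightarrow> ('i \<Rightarrow> 'a) \<Rightarrow> ennreal"
  assumes "finite I" "finite V" "k > 0"
    and "\<And>v. v \<in> V \<Longrightarrow> S v \<subseteq> I"
    and "\<And>e. e \<in> I \<Longrightarrow> card {v \<in> V. e \<in> S v} = k"
    and "\<And>v. v \<in> V \<Longrightarrow> F v \<in> borel_measurable (PiM (S v) M)"
  shows "(\<integral>\<^sup>+x. (\<Prod>v\<in>V. ennroot k (F v (restrict x (S v)))) \<partial>PiM I M)
      \<le> (\<Prod>v\<in>V. ennroot k (\<integral>\<^sup>+x. F v x \<partial>PiM (S v) M))"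
  using assms
\<comment> \<open>\<open>S\<close> and \<open>F\<close> must vary, because integrating out one
  coordinate changes both.\<close>
proof (induction I arbitrary: S F rule: finite_induct)
  case empty
  then show ?case
    by (simp add: nn_integral_empty restrict_def del: nn_integral_const)
next
  case (insert e I)
  note meas = insert.prems(5)
  \<comment> \<open>\<open>V1\<close> collects the factors that depend on the new coordinate
    \<open>e\<close>. The covering hypothesis gives it exactly \<open>k\<close> members, the number
    of factors that Hoelder's inequality with \<open>k\<close>-th roots requires.\<close>
  define V1 where "V1 = {v \<in> V. e \<in> S v}"
  define V0 where "V0 = {v \<in> V. e \<notin> S v}"
  have V: "V = V0 \<union> V1" "V0 \<inter> V1 = {}" "finite V0" "finite V1"
    using insert.prems by (auto simp: V0_def V1_def)
  have V1: "card V1 = k" "V1 \<noteq> {}"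
    using insert.prems(4)[of e] \<open>k > 0\<close> by (auto simp: V1_def simp del: Collect_empty_eq)
  define S' where "S' v = S v - {e}" for v
  \<comment> \<open>The coordinate \<open>e\<close> is integrated out of each factor that depends on
    it. By Fubini the total integrals do not change, which is \<open>int'\<close> below.\<close>
  define F' where "F' v x = (if e \<in> S v then \<integral>\<^sup>+y. F v (x(e := y)) \<partial>M e else F v x)" for v x
  have S': "finite (S' v)" "e \<notin> S' v" "S' v \<subseteq> I" if "v \<in> V" for v
    using insert.prems(3)[OF that] insert.hyps by (auto simp: S'_def intro: finite_subset)
  have S'1: "S v = insert e (S' v)" if "v \<in> V1" for v
    using that by (auto simp: V1_def S'_def)
  have S'0: "S v = S' v" if "v \<in> V0" for v
    using that by (auto simp: V0_def S'_def)
  have meas1: "(\<lambda>(x, y). F v (x(e := y))) \<in> borel_measurable (PiM (S' v) M \<Otimes>\<^sub>M M e)" if "v \<in> V1" for v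
  proof -
    have "v \<in> V" using that V by auto
    from meas[OF this] have [measurable]: "F v \<in> borel_measurable (PiM (insert e (S' v)) M)"
      using S'1[OF that] by simp
    show ?thesis by measurable
  qed
  have meas': "F' v \<in> borel_measurable (PiM (S' v) M)" if "v \<in> V" for v
  proof (cases "e \<in> S v")
    case True
    then have "v \<in> V1" using that by (simp add: V1_def)
    from meas1[OF this] show ?thesis
      using True sigma_finite_measure.borel_measurable_nn_integral[OF sigma_finite_measures]
      by (simp add: F'_def[abs_def])
  next
    case False
    then show ?thesis
      using meas[OF that] that S'0[of v] by (simp add: F'_def[abs_def] V0_def)
  qed
  have int': "(\<integral>\<^sup>+x. F' v x \<partial>PiM (S' v) M) = (\<integral>\<^sup>+x. F v x \<partial>PiM (S v) M)" if "v \<in> V" for v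
  proof (cases "e \<in> S v")
    case True
    then have v: "v \<in> V1" using that by (simp add: V1_def)
    show ?thesis
      using True S'[OF that] meas[OF that] S'1[OF v]
      by (simp add: F'_def product_nn_integral_insert)
  next
    case False
    then show ?thesis
      using that S'0[of v] by (simp add: F'_def V0_def)
  qed
  have restr1: "restrict (x(e := y)) (S v) = (restrict x (S' v))(e := y)" if "v \<in> V1" for x :: "'i \<Rightarrow> 'a" and y v
    using that by (auto simp: V1_def S'_def restrict_def)
  have restr0: "restrict (x(e := y)) (S v) = restrict x (S' v)" if "v \<in> V0" for x :: "'i \<Rightarrow> 'a" and y v
    using that by (auto simp: V0_def S'_def restrict_def)
  have [measurable]: "(\<lambda>x. F v (restrict x (S v))) \<in> borel_measurable (PiM (insert e I) M)" if "v \<in> V" for v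
    using measurable_compose[OF measurable_restrict_subset[OF insert.prems(3)[OF that]] meas[OF that]] .
  have "(\<integral>\<^sup>+x. (\<Prod>v\<in>V. ennroot k (F v (restrict x (S v)))) \<partial>PiM (insert e I) M)
      = (\<integral>\<^sup>+x. \<integral>\<^sup>+y. (\<Prod>v\<in>V. ennroot k (F v (restrict (x(e := y)) (S v)))) \<partial>M e \<partial>PiM I M)"
    by (subst product_nn_integral_insert) (use insert.hyps in auto)
  also have "\<dots> \<le> (\<integral>\<^sup>+x. (\<Prod>v\<in>V. ennroot k (F' v (restrict x (S' v)))) \<partial>PiM I M)"
  proof (intro nn_integral_mono)
    fix x assume x: "x \<in> space (PiM I M)"
    have m: "(\<lambda>y. F v ((restrict x (S' v))(e := y))) \<in> borel_measurable (M e)" if "v \<in> V1" for v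
    proof -
      have "restrict x (S' v) \<in> space (PiM (S' v) M)"
        using x S'(3)[of v] that V by (auto simp: space_PiM PiE_iff)
      from measurable_compose[OF measurable_Pair1'[OF this] meas1[OF that]] show ?thesis by simp
    qed
    have [measurable]: "(\<lambda>y. ennroot k (F v ((restrict x (S' v))(e := y)))) \<in> borel_measurable (M e)" if "v \<in> V1" for v
      using m[OF that] by measurable
    \<comment> \<open>For fixed \<open>x\<close> the factors from \<open>V0\<close> are constant in
      \<open>y\<close> and leave the integral; Hoelder's inequality bounds what remains.\<close>
    have "(\<integral>\<^sup>+y. (\<Prod>v\<in>V. ennroot k (F v (restrict (x(e := y)) (S v)))) \<partial>M e)
        = (\<integral>\<^sup>+y. (\<Prod>v\<in>V0. ennroot k (F v (restrict x (S' v)))) *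
                (\<Prod>v\<in>V1. ennroot k (F v ((restrict x (S' v))(e := y)))) \<partial>M e)"
      using V by (simp add: prod.union_disjoint restr0 restr1)
    also have "\<dots> = (\<Prod>v\<in>V0. ennroot k (F v (restrict x (S' v)))) *
                (\<integral>\<^sup>+y. (\<Prod>v\<in>V1. ennroot k (F v ((restrict x (S' v))(e := y)))) \<partial>M e)"
      by (rule nn_integral_cmult) measurable
    also have "\<dots> \<le> (\<Prod>v\<in>V0. ennroot k (F v (restrict x (S' v)))) *
                (\<Prod>v\<in>V1. ennroot k (\<integral>\<^sup>+y. F v ((restrict x (S' v))(e := y)) \<partial>M e))"
      using V V1 m by (intro mult_left_mono nn_integral_prod_ennroot_le) auto
    also have "(\<Prod>v\<in>V0. ennroot k (F v (restrict x (S' v)))) = (\<Prod>v\<in>V0. ennroot k (F' v (restrict x (S' v))))"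
      by (intro prod.cong) (auto simp: V0_def F'_def)
    also have "(\<Prod>v\<in>V1. ennroot k (\<integral>\<^sup>+y. F v ((restrict x (S' v))(e := y)) \<partial>M e)) =
        (\<Prod>v\<in>V1. ennroot k (F' v (restrict x (S' v))))"
      by (intro prod.cong) (auto simp: V1_def F'_def)
    finally show "(\<integral>\<^sup>+y. (\<Prod>v\<in>V. ennroot k (F v (restrict (x(e := y)) (S v)))) \<partial>M e)
        \<le> (\<Prod>v\<in>V. ennroot k (F' v (restrict x (S' v))))"
      by (simp only: V(1) prod.union_disjoint[OF V(3,4,2)])
  qed
  also have "\<dots> \<le> (\<Prod>v\<in>V. ennroot k (\<integral>\<^sup>+x. F' v x \<partial>PiM (S' v) M))"
  proof (rule insert.IH)
    fix f assume "f \<in> I"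
    \<comment> \<open>Here \<open>f\<close> differs from \<open>e\<close>, so removing
      \<open>e\<close> does not change how often \<open>f\<close> is covered.\<close>
    then have "{v \<in> V. f \<in> S' v} = {v \<in> V. f \<in> S v}"
      using insert.hyps by (auto simp: S'_def)
    then show "card {v \<in> V. f \<in> S' v} = k"
      using insert.prems(4)[of f] \<open>f \<in> I\<close> by simp
  qed (use insert.prems S' meas' in auto)
  also have "\<dots> = (\<Prod>v\<in>V. ennroot k (\<integral>\<^sup>+x. F v x \<partial>PiM (S v) M))"
    by (simp add: int')
  finally show ?case .
qed

text \<open>The geometric form, obtained from indicator functions. Their values 0 and 1 are fixed by
  the root, and a point of \<open>A\<close> projects into every \<open>B v\<close>, so the indicator
  of \<open>A\<close> is below the product. Raising to the power \<open>k\<close> clears the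
  roots.\<close>

lemma (in product_sigma_finite) emeasure_PiM_power_le_prod:
  assumes I: "finite I" and V: "finite V" and k: "k > 0"
    and S: "\<And>v. v \<in> V \<Longrightarrow> S v \<subseteq> I"
    and cover: "\<And>e. e \<in> I \<Longrightarrow> card {v \<in> V. e \<in> S v} = k"
    and A: "A \<in> sets (PiM I M)"
    and B: "\<And>v. v \<in> V \<Longrightarrow> B v \<in> sets (PiM (S v) M)"
    and AB: "\<And>v x. v \<in> V \<Longrightarrow> x \<in> A \<Longrightarrow> restrict x (S v) \<in> B v"
  shows "emeasure (PiM I M) A ^ k \<le> (\<Prod>v\<in>V. emeasure (PiM (S v) M) (B v))"
proof -
  have "emeasure (PiM I M) A = (\<integral>\<^sup>+x. indicator A x \<partial>PiM I M)"
    using A by simp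
  also have "\<dots> \<le> (\<integral>\<^sup>+x. (\<Prod>v\<in>V. ennroot k (indicator (B v) (restrict x (S v)))) \<partial>PiM I M)"
  proof (intro nn_integral_mono)
    fix x
    show "indicator A x \<le> (\<Prod>v\<in>V. ennroot k (indicator (B v) (restrict x (S v))))"
      using AB k by (cases "x \<in> A") auto
  qed
  also have "\<dots> \<le> (\<Prod>v\<in>V. ennroot k (\<integral>\<^sup>+x. indicator (B v) x \<partial>PiM (S v) M))"
    using B by (intro nn_integral_PiM_prod_ennroot_le I V k S cover) auto
  also have "\<dots> = (\<Prod>v\<in>V. ennroot k (emeasure (PiM (S v) M) (B v)))"
    using B by simp
  finally have "emeasure (PiM I M) A ^ k \<le> (\<Prod>v\<in>V. ennroot k (emeasure (PiM (S v) M) (B v))) ^ k"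
    by (rule power_mono_ennreal)
  also have "\<dots> = (\<Prod>v\<in>V. emeasure (PiM (S v) M) (B v))"
    using k by (simp add: prod_power_distrib)
  finally show ?thesis .
qed

section \<open>Relabelling coordinates\<close>

text \<open>A product measure with equal factors is determined by its values on boxes, and
  relabelling only permutes the sides of a box. This will identify the volume of a polytope on any
  \<open>n\<close> vertices with that on \<open>{1..n}\<close>.\<close>

lemma distr_PiM_bij_betw:
  assumes I: "finite I" and f: "bij_betw f I J" and N: "sigma_finite_measure N"
  shows "distr (PiM J (\<lambda>_. N)) (PiM I (\<lambda>_. N)) (\<lambda>x. \<lambda>i\<in>I. x (f i)) = PiM I (\<lambda>_. N)"
proof -
  interpret product_sigma_finite "\<lambda>_. N"
    using N by (simp add: product_sigma_finite_def)
  have J: "finite J" using I f by (simp add: bij_betw_finite)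
  have fJ: "f i \<in> J" if "i \<in> I" for i using f that by (auto simp: bij_betw_def)
  have m: "(\<lambda>x. \<lambda>i\<in>I. x (f i)) \<in> measurable (PiM J (\<lambda>_. N)) (PiM I (\<lambda>_. N))"
    by (intro measurable_restrict measurable_component_singleton fJ)
  show ?thesis
  proof (rule PiM_eqI[OF I])
    fix A assume A: "\<And>i. i \<in> I \<Longrightarrow> A i \<in> sets N"
    let ?g = "the_inv_into I f"
    have g: "?g j \<in> I" "f (?g j) = j" if "j \<in> J" for j
      using f that by (auto simp: bij_betw_def the_inv_into_into f_the_inv_into_f)
    have gf: "?g (f i) = i" if "i \<in> I" for i
      using f that by (auto simp: bij_betw_def the_inv_into_f_f)
    have "(\<lambda>x. \<lambda>i\<in>I. x (f i)) -` Pi\<^sub>E I A \<inter> space (PiM J (\<lambda>_. N)) = (\<Pi>\<^sub>E j\<in>J. A (?g j))"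
    proof (intro set_eqI iffI)
      fix x assume "x \<in> (\<lambda>x. \<lambda>i\<in>I. x (f i)) -` Pi\<^sub>E I A \<inter> space (PiM J (\<lambda>_. N))"
      then have x: "\<And>i. i \<in> I \<Longrightarrow> x (f i) \<in> A i" "x \<in> extensional J"
        by (auto simp: PiE_iff space_PiM)
      show "x \<in> (\<Pi>\<^sub>E j\<in>J. A (?g j))"
        using x(1)[OF g(1)] x(2) by (auto simp: PiE_iff g)
    next
      fix x assume "x \<in> (\<Pi>\<^sub>E j\<in>J. A (?g j))"
      then have x: "\<And>j. j \<in> J \<Longrightarrow> x j \<in> A (?g j)" "x \<in> extensional J"
        by (auto simp: PiE_iff)
      have "x (f i) \<in> A i" if "i \<in> I" for i using x(1)[OF fJ[OF that]] gf[OF that] by simp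
      moreover have "x j \<in> space N" if "j \<in> J" for j
        using x(1)[OF that] A[OF g(1)[OF that]] sets.sets_into_space by blast
      ultimately show "x \<in> (\<lambda>x. \<lambda>i\<in>I. x (f i)) -` Pi\<^sub>E I A \<inter> space (PiM J (\<lambda>_. N))"
        using x(2) by (auto simp: PiE_iff space_PiM)
    qed
    then have "emeasure (distr (PiM J (\<lambda>_. N)) (PiM I (\<lambda>_. N)) (\<lambda>x. \<lambda>i\<in>I. x (f i))) (Pi\<^sub>E I A)
        = emeasure (PiM J (\<lambda>_. N)) (\<Pi>\<^sub>E j\<in>J. A (?g j))"
      using A I m by (subst emeasure_distr) (auto intro!: sets_PiM_I_finite)
    also have "\<dots> = (\<Prod>j\<in>J. emeasure N (A (?g j)))"
      using A g J by (intro emeasure_PiM) auto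
    also have "\<dots> = (\<Prod>i\<in>I. emeasure N (A i))"
      by (subst prod.reindex_bij_betw[OF f, symmetric]) (simp add: gf)
    finally show "emeasure (distr (PiM J (\<lambda>_. N)) (PiM I (\<lambda>_. N)) (\<lambda>x. \<lambda>i\<in>I. x (f i))) (Pi\<^sub>E I A)
        = (\<Prod>i\<in>I. emeasure N (A i))" .
  qed simp
qed

interpretation lborel_PiM: product_sigma_finite "\<lambda>_ :: nat set. lborel :: real measure"
  by (simp add: product_sigma_finite_def lborel.sigma_finite_measure_axioms)

section \<open>Deleting a vertex from the metric polytope\<close>

text \<open>An injection of vertices carries pairs to pairs and distinct triples to distinct
  triples, so every constraint on the pulled-back array is already one on \<open>d\<close>. With an
  image that omits one vertex, this is vertex deletion.\<close>

lemma metric_polytope_relabel: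
  assumes g: "inj_on g {1..m}" "g ` {1..m} \<subseteq> {1..n}" and d: "d \<in> metric_polytope n"
  shows "(\<lambda>e\<in>nsets {1..m} 2. d (g ` e)) \<in> metric_polytope m"
proof -
  have e: "g ` e \<in> nsets {1..n} 2" if "e \<in> nsets {1..m} 2" for e
    using that g by (auto simp: nsets_def card_image inj_on_subset intro: finite_subset)
  have gin: "g i \<in> {1..n}" if "i \<in> {1..m}" for i using g(2) imageI[OF that, of g] by (rule subsetD)
  have gne: "g i \<noteq> g j" if "i \<in> {1..m}" "j \<in> {1..m}" "i \<noteq> j" for i j
    using inj_onD[OF g(1)] that by blast
  have tri: "a \<noteq> b \<and> b \<noteq> c \<and> a \<noteq> c \<longrightarrow> d {a, b} \<le> d {a, c} + d {c, b}"
    if "a \<in> {1..n}" "b \<in> {1..n}" "c \<in> {1..n}" for a b c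
  proof -
    have "\<forall>a\<in>{1..n}. \<forall>b\<in>{1..n}. \<forall>c\<in>{1..n}.
        a \<noteq> b \<and> b \<noteq> c \<and> a \<noteq> c \<longrightarrow> d {a, b} \<le> d {a, c} + d {c, b}"
      using d unfolding metric_polytope_def mem_Collect_eq by (elim conjE)
    from bspec[OF bspec[OF bspec[OF this that(1)] that(2)] that(3)] show ?thesis .
  qed
  show ?thesis
    unfolding metric_polytope_def
  proof (intro CollectI conjI ballI impI)
    let ?d = "\<lambda>e\<in>nsets {1..m} 2. d (g ` e)"
    show "?d \<in> nsets {1..m} 2 \<rightarrow>\<^sub>E UNIV" by simp
    show "0 < ?d f" "?d f \<le> 2" if "f \<in> nsets {1..m} 2" for f
      using d e[OF that] that by (simp_all add: metric_polytope_def)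
    show "?d {i, j} \<le> ?d {i, k} + ?d {k, j}"
      if "i \<in> {1..m}" "j \<in> {1..m}" "k \<in> {1..m}" "i \<noteq> j \<and> j \<noteq> k \<and> i \<noteq> k" for i j k
    proof -
      have "d {g i, g j} \<le> d {g i, g k} + d {g k, g j}"
        using tri[OF gin gin gin] gne that by simp
      moreover have "{i, j} \<in> nsets {1..m} 2" "{i, k} \<in> nsets {1..m} 2" "{k, j} \<in> nsets {1..m} 2"
        using that by auto
      ultimately show ?thesis by (simp del: doubleton_in_nsets_2)
    qed
  qed
qed

text \<open>The polytope lies in a cube of side 2. Finiteness matters because \<open>measure\<close>
  returns 0 on a set of infinite measure.\<close>

lemma emeasure_metric_polytope_finite: "emeasure (pair_lborel n) (metric_polytope n) < top"
proof -
  have fin: "finite (nsets {1..n} 2)" by (simp add: finite_imp_finite_nsets)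
  have "emeasure (pair_lborel n) (metric_polytope n)
      \<le> emeasure (pair_lborel n) (\<Pi>\<^sub>E e\<in>nsets {1..n} 2. {0..2})"
    unfolding pair_lborel_def using fin
    by (intro emeasure_mono sets_PiM_I_finite) (simp_all add: metric_polytope_def PiE_iff less_imp_le subset_iff)
  also have "\<dots> = (\<Prod>e\<in>nsets {1..n} 2. 2)"
    unfolding pair_lborel_def using fin by (subst lborel_PiM.emeasure_PiM) auto
  also have "\<dots> < top"
    by (simp add: power_less_top_ennreal)
  finally show ?thesis .
qed

lemma emeasure_metric_polytope_Suc_power_le:
  assumes n: "n \<ge> 2"
  shows "emeasure (pair_lborel (Suc n)) (metric_polytope (Suc n)) ^ (n - 1)
      \<le> emeasure (pair_lborel n) (metric_polytope n) ^ Suc n"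
proof -
  let ?V = "{1..Suc n}" and ?I = "\<lambda>n. nsets {1..n::nat} 2"
  \<comment> \<open>\<open>S v\<close> holds the pairs that survive when \<open>v\<close> is
    deleted.\<close>
  define S where "S v = nsets (?V - {v}) 2" for v
  have "\<exists>g. bij_betw g {1..n} (?V - {v})" if "v \<in> ?V" for v
    using that by (intro finite_same_card_bij) auto
  then obtain g where g: "\<And>v. v \<in> ?V \<Longrightarrow> bij_betw (g v) {1..n} (?V - {v})"
    by metis
  define T where "T v x = (\<lambda>e\<in>?I n. x (g v ` e))" for v and x :: "nat set \<Rightarrow> real"
  \<comment> \<open>\<open>B v\<close> is a copy of the polytope on the \<open>n\<close> vertices
    other than \<open>v\<close>; \<open>g v\<close> numbers these vertices by \<open>{1..n}\<close>
    in an arbitrary way.\<close>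
  define B where "B v = T v -` metric_polytope n \<inter> space (PiM (S v) (\<lambda>_. lborel))" for v
  have fin: "finite (?I m)" for m by (simp add: finite_imp_finite_nsets)
  have bij: "bij_betw ((`) (g v)) (?I n) (S v)" if "v \<in> ?V" for v
    unfolding S_def by (intro bij_betw_nsets g that)
  have distr: "distr (PiM (S v) (\<lambda>_. lborel)) (pair_lborel n) (T v) = pair_lborel n" if "v \<in> ?V" for v
    unfolding pair_lborel_def T_def[abs_def]
    by (intro distr_PiM_bij_betw fin bij that lborel.sigma_finite_measure_axioms)
  have T: "T v \<in> measurable (PiM (S v) (\<lambda>_. lborel)) (pair_lborel n)" if "v \<in> ?V" for v
    unfolding pair_lborel_def T_def[abs_def]
    using bij[OF that] by (intro measurable_restrict measurable_component_singleton) (auto simp: bij_betw_def)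
  have B: "B v \<in> sets (PiM (S v) (\<lambda>_. lborel))" if "v \<in> ?V" for v
    unfolding B_def by (rule measurable_sets[OF T[OF that] sets_metric_polytope])
  have emB: "emeasure (PiM (S v) (\<lambda>_. lborel)) (B v) = emeasure (pair_lborel n) (metric_polytope n)" if "v \<in> ?V" for v
    unfolding B_def using emeasure_distr[OF T[OF that] sets_metric_polytope] distr[OF that] by simp
  have "emeasure (PiM (?I (Suc n)) (\<lambda>_. lborel)) (metric_polytope (Suc n)) ^ (n - 1)
      \<le> (\<Prod>v\<in>?V. emeasure (PiM (S v) (\<lambda>_. lborel)) (B v))"
  proof (rule lborel_PiM.emeasure_PiM_power_le_prod[OF fin])
    show "S v \<subseteq> ?I (Suc n)" for v
      unfolding S_def by (intro nsets_mono) auto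
    show "card {v \<in> ?V. e \<in> S v} = n - 1" if "e \<in> ?I (Suc n)" for e
    proof -
      have e: "e \<subseteq> ?V" "finite e" "card e = 2" using that by (auto simp: nsets_def)
      \<comment> \<open>A pair survives unless one of its two endpoints is deleted, which leaves
        \<open>n + 1 - 2\<close> vertices; this is positive as \<open>n \<ge> 2\<close>.\<close>
      have "{v \<in> ?V. e \<in> S v} = ?V - e"
        using e by (auto simp: S_def nsets_def)
      then show ?thesis using e by (simp add: card_Diff_subset)
    qed
    show "metric_polytope (Suc n) \<in> sets (PiM (?I (Suc n)) (\<lambda>_. lborel))"
      using sets_metric_polytope[of "Suc n"] by (simp add: pair_lborel_def)
    show "restrict x (S v) \<in> B v" if v: "v \<in> ?V" and x: "x \<in> metric_polytope (Suc n)" for v x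
    proof -
      have "T v (restrict x (S v)) = (\<lambda>e\<in>?I n. x (g v ` e))"
        unfolding T_def using bij_betwE[OF bij[OF v]] by (intro restrict_ext) simp
      also have "\<dots> \<in> metric_polytope n"
        using g[OF v] x by (intro metric_polytope_relabel) (auto simp: bij_betw_def)
      finally show ?thesis
        by (simp add: B_def space_PiM)
    qed
  qed (use n B in auto)
  also have "\<dots> = emeasure (pair_lborel n) (metric_polytope n) ^ Suc n"
    by (simp add: emB)
  finally show ?thesis
    by (simp add: pair_lborel_def)
qed

section \<open>Normalising exponents and monotonicity\<close>

lemma powr_inverse_choose_two_le:
  fixes a b :: real
  assumes n: "n \<ge> 2" and "0 \<le> a" "0 \<le> b" and le: "a ^ (n - 1) \<le> b ^ Suc n"
  shows "a powr (1 / real (Suc n choose 2)) \<le> b powr (1 / real (n choose 2))"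
proof -
  have c: "real (m choose 2) = real m * (real m - 1) / 2" for m
    by (simp add: choose_two real_of_nat_div of_nat_diff algebra_simps)
  \<comment> \<open>At \<open>x = 0\<close> both sides are 0, since \<open>0 powr t = 0\<close> for
    every \<open>t\<close>; \<open>k > 0\<close> excludes \<open>0 ^ 0 = 1\<close>.\<close>
  have P: "(x ^ k) powr t = x powr (real k * t)" if "0 \<le> x" "k > 0" for x t :: real and k
    using that by (cases "x = 0") (auto simp: powr_realpow[symmetric] powr_powr)
  \<comment> \<open>Chosen so that raising the hypothesis to the power \<open>t\<close> produces
    both target exponents: \<open>1 / t\<close> is the common value of
    \<open>(n - 1) * (Suc n choose 2)\<close> and \<open>(n + 1) * (n choose 2)\<close>.\<close>
  define t where "t = 2 / (real n * (real n - 1) * (real n + 1))"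
  have t: "1 / real (Suc n choose 2) = real (n - 1) * t" "1 / real (n choose 2) = real (Suc n) * t"
  proof -
    have "real n > 1" using n by simp
    then show "1 / real (Suc n choose 2) = real (n - 1) * t" "1 / real (n choose 2) = real (Suc n) * t"
      by (simp_all add: c t_def of_nat_diff add_pos_pos less_imp_neq[symmetric] nonzero_divide_eq_eq nonzero_eq_divide_eq mult.assoc)
        (simp add: algebra_simps)
  qed
  have "t \<ge> 0" using n by (simp add: t_def)
  then have "(a ^ (n - 1)) powr t \<le> (b ^ Suc n) powr t"
    using le \<open>0 \<le> a\<close> by (intro powr_mono2) simp_all
  then show ?thesis
    using n \<open>0 \<le> a\<close> \<open>0 \<le> b\<close> by (simp only: t P[of a "n - 1"] P[of b "Suc n"])
qed

theorem proposition1p1: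
  "antimono_on {2::nat..}
     (\<lambda>n. measure (pair_lborel n) (metric_polytope n) powr (1 / real (n choose 2)))"
proof (rule monotone_onI)
  let ?vol = "\<lambda>n. measure (pair_lborel n) (metric_polytope n)"
  have em: "emeasure (pair_lborel n) (metric_polytope n) = ennreal (?vol n)" for n
    using emeasure_metric_polytope_finite[of n] by (intro emeasure_eq_ennreal_measure) auto
  have vol_Suc: "?vol (Suc n) powr (1 / real (Suc n choose 2)) \<le> ?vol n powr (1 / real (n choose 2))"
    if "2 \<le> n" for n
  proof (rule powr_inverse_choose_two_le[OF that])
    have "ennreal (?vol (Suc n) ^ (n - 1)) \<le> ennreal (?vol n ^ Suc n)"
      using emeasure_metric_polytope_Suc_power_le[OF that] by (simp only: em ennreal_power measure_nonneg)
    then show "?vol (Suc n) ^ (n - 1) \<le> ?vol n ^ Suc n"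
      by (subst (asm) ennreal_le_iff) auto
  qed simp_all
  fix m n :: nat
  assume "m \<in> {2..}" "m \<le> n"
  from \<open>m \<le> n\<close> show "?vol n powr (1 / real (n choose 2)) \<le> ?vol m powr (1 / real (m choose 2))"
  \<comment> \<open>The one-step inequality is chained upwards from \<open>m\<close>; every index
    met is at least 2 because \<open>m\<close> is.\<close>
  proof (induction n rule: dec_induct)
    case (step n)
    then have "2 \<le> n" using \<open>m \<in> {2..}\<close> by simp
    then show ?case using vol_Suc step.IH by (meson order_trans)
  qed simp
qed

end
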